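(* Let $z_C\in\mathbb{C}$, let $0\le\varphi_1<\varphi_2<2\pi$, let the two rays issuing from $z_C$ with angles $\varphi_1,\varphi_2$ subdivide the complex plane into two sectors, and let $$G_1=\{z_C+re^{i\varphi}: r>0,\ \varphi_1<\varphi<\varphi_2\}$$ be the first of them. Put $\alpha_1=\varphi_2-\varphi_1$. Let $f$ be a complex-valued function on the complex plane (not assumed analytic) such that there is a vector $\vec A_{\infty 1}\in\mathbb{C}^2$ with $$\lim_{|\zeta|\to+\infty,\ z_C+\zeta\in G_1}\bigl(-\overline{\zeta}\,\vec w_1+\zeta\,\vec w_2\bigr)f(z_C+\zeta)=\vec A_{\infty 1}.$$ Then $$\int_{\mathrm{ext}\,\vec\varrho_\infty}f\,d\vec\varrho=2\pi i\sum_{\vec\varrho_N\in\vec\varrho}\overrightarrow{\mathrm{Res}}_{\vec\varrho=\vec\varrho_N}f-\alpha_1\, i\,\vec A_{\infty 1},$$ where the left-hand side is the integral over the arc at infinity lying outside $G_1$, and the sum on the right is the absolute integral sum of the residues of $f$ over all points of the complex plane, both as defined in the context.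
   Context: Vectors: $\vec w_1,\vec w_2$ is the standard basis of $\mathbb{C}^2$. A point $z$ of the complex plane is identified with $\vec\varrho=\bar z\,\vec w_1+z\,\vec w_2$ (the paper writes $z^*$ for $\bar z$), so that $\vec\varrho-2z^*\vec w_1=-\bar z\,\vec w_1+z\,\vec w_2$. For an oriented path $\gamma$, $\int_\gamma f\,d\vec\varrho=\bigl(\int_\gamma f\,d\bar z\bigr)\vec w_1+\bigl(\int_\gamma f\,dz\bigr)\vec w_2\in\mathbb{C}^2$. Closed curves and circular arcs are traversed counterclockwise. Residue: at a point $z_N$, $2\pi i\,\overrightarrow{\mathrm{Res}}_{\vec\varrho=\vec\varrho_N}f=\lim_{\delta\to0^+}\oint_{|z-z_N|=\delta}f\,d\vec\varrho$ (the integral over an "infinitesimally small" circle centred at $z_N$). Sum over all points: $2\pi i\sum_{\vec\varrho_N\in\vec\varrho}\overrightarrow{\mathrm{Res}}_{\vec\varrho=\vec\varrho_N}f$ is not an ordinary series over nonzero terms but an absolute integral sum (an infinite sum in which infinitely many individually vanishing terms may have a nonzero total, as with an integral). For the disc $D_R=\{|z-z_C|\le R\}$ it is the limit, along successive refinements $D_n$ of subdivisions of $D_R$ into finitely many cells by lines parallel to the coordinate axes, the cells shrinking to points, of $\sum_{\text{cells }\Delta}\oint_{\partial\Delta}f\,d\vec\varrho$. For the whole plane it is the limit of these values as $R\to+\infty$. Arc at infinity: $\int_{\mathrm{ext}\,\vec\varrho_\infty}f\,d\vec\varrho=\lim_{R\to+\infty}\int_{\Gamma_R}f\,d\vec\varrho$,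 where $\Gamma_R=\{z_C+Re^{i\varphi}:\varphi_2\le\varphi\le\varphi_1+2\pi\}$. Standing assumptions: $f$ is integrable on the circles $|z-z_C|=R$ for all large $R$ and on the boundaries of the cells of the subdivisions used, and the absolute integral sum over the whole plane exists in $\mathbb{C}^2$. *)

theory Defs
  imports "HOL-Complex_Analysis.Complex_Analysis"
begin

section \<open>Integrals with respect to the vector differential\<close>

definition w1 :: "complex ^ 2" where "w1 = axis 1 1"
definition w2 :: "complex ^ 2" where "w2 = axis 2 1"

text \<open>
  The integral of \<open>f\<close> along \<open>\<gamma>\<close> with respect to the conjugate differential, in the format of
  \<^const>\<open>has_contour_integral\<close> (which is the integral with respect to \<open>dz\<close>).
\<close>

definition has_conj_integral :: "(complex \<Rightarrow> complex) \<Rightarrow> complex \<Rightarrow> (real \<Rightarrow> complex) \<Rightarrow> bool" where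
  "has_conj_integral f I \<gamma> \<longleftrightarrow>
     ((\<lambda>t. f (\<gamma> t) * cnj (vector_derivative \<gamma> (at t within {0..1}))) has_integral I) {0..1}"

definition has_vec_integral :: "(complex \<Rightarrow> complex) \<Rightarrow> complex ^ 2 \<Rightarrow> (real \<Rightarrow> complex) \<Rightarrow> bool" where
  "has_vec_integral f V \<gamma> \<longleftrightarrow>
     (\<exists>I J. has_conj_integral f I \<gamma> \<and> (f has_contour_integral J) \<gamma> \<and> V = I *s w1 + J *s w2)"

definition vec_integrable :: "(complex \<Rightarrow> complex) \<Rightarrow> (real \<Rightarrow> complex) \<Rightarrow> bool" where
  "vec_integrable f \<gamma> \<longleftrightarrow> (\<exists>V. has_vec_integral f V \<gamma>)"

definition vec_integral :: "(complex \<Rightarrow> complex) \<Rightarrow> (real \<Rightarrow> complex) \<Rightarrow> complex ^ 2" where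
  "vec_integral f \<gamma> = (THE V. has_vec_integral f V \<gamma>)"

section \<open>Subdivisions of a disc by lines parallel to the axes\<close>

definition consecutive :: "real set \<Rightarrow> real \<Rightarrow> real \<Rightarrow> bool" where
  "consecutive X s t \<longleftrightarrow> s \<in> X \<and> t \<in> X \<and> s < t \<and> X \<inter> {s<..<t} = {}"

text \<open>
  A subdivision of the disc \<^term>\<open>cball c R\<close> is given by the pair \<open>(X, Y)\<close> of the sets of abscissae
  of its vertical lines and of ordinates of its horizontal lines. Every cell is the intersection of
  the disc with an axis-parallel rectangle, which we represent by its lower left and upper right
  corners; the outermost rectangles are bounded by the tangents of the circle. A rectangle near a
  corner of the circumscribed square may miss the interior of the disc; the boundary integral
  defined below is then 0.
\<close>

definition subdivision :: "complex \<Rightarrow> real \<Rightarrow> real set \<times> real set \<Rightarrow> bool" where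
  "subdivision c R D \<longleftrightarrow>
     finite (fst D) \<and> fst D \<subseteq> {Re c - R<..<Re c + R} \<and>
     finite (snd D) \<and> snd D \<subseteq> {Im c - R<..<Im c + R}"

definition rectangles :: "complex \<Rightarrow> real \<Rightarrow> real set \<times> real set \<Rightarrow> (complex \<times> complex) set" where
  "rectangles c R D =
     {(a, b). consecutive (fst D \<union> {Re c - R, Re c + R}) (Re a) (Re b) \<and>
              consecutive (snd D \<union> {Im c - R, Im c + R}) (Im a) (Im b)}"

definition cell :: "complex \<Rightarrow> real \<Rightarrow> complex \<times> complex \<Rightarrow> complex set" where
  "cell c R Q = cbox (fst Q) (snd Q) \<inter> cball c R"

definition refining_subdivisions :: "complex \<Rightarrow> real \<Rightarrow> (nat \<Rightarrow> real set \<times> real set) \<Rightarrow> bool" where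
  "refining_subdivisions c R D \<longleftrightarrow>
     (\<forall>n. subdivision c R (D n)) \<and>
     (\<forall>n. fst (D n) \<subseteq> fst (D (Suc n)) \<and> snd (D n) \<subseteq> snd (D (Suc n))) \<and>
     (\<forall>\<epsilon>>0. \<forall>\<^sub>F n in sequentially. \<forall>Q \<in> rectangles c R (D n). diameter (cell c R Q) < \<epsilon>)"

section \<open>Integrals over cell boundaries\<close>

definition restrict_to :: "complex set \<Rightarrow> (complex \<Rightarrow> complex) \<Rightarrow> complex \<Rightarrow> complex" where
  "restrict_to S f = (\<lambda>z. if z \<in> S then f z else 0)"

lemma frontier_cell:
  assumes "Re a \<le> Re b" "Im a \<le> Im b" "R > 0"
  shows "frontier (cell c R (a, b)) =
           (path_image (rectpath a b) \<inter> cball c R) \<union> (path_image (circlepath c R) \<inter> cbox a b)"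
proof -
  have "frontier (cbox a b \<inter> cball c R) =
          (frontier (cbox a b) \<inter> cball c R) \<union> (cbox a b \<inter> frontier (cball c R))"
    by (rule frontier_Int_closed) auto
  moreover have "frontier (cbox a b) = path_image (rectpath a b)"
    using assms by (simp add: frontier_cbox path_image_rectpath_cbox_minus_box)
  moreover have "frontier (cball c R) = path_image (circlepath c R)"
    using assms by simp
  ultimately show ?thesis
    by (simp add: cell_def Int_commute)
qed

text \<open>
  By the preceding lemma, the boundary of a cell consists of the part of the boundary of the
  rectangle that lies in the disc and the part of the circle that lies in the rectangle. The
  counterclockwise orientation of the cell boundary is that of the rectangle boundary on the first
  part and that of the circle on the second. The two parts meet only in finitely many points.
\<close>

definition boundary_integrable ::
    "(complex \<Rightarrow> complex) \<Rightarrow> complex \<Rightarrow> real \<Rightarrow> complex \<times> complex \<Rightarrow> bool" where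
  "boundary_integrable f c R Q \<longleftrightarrow>
     vec_integrable (restrict_to (cball c R) f) (rectpath (fst Q) (snd Q)) \<and>
     vec_integrable (restrict_to (cbox (fst Q) (snd Q)) f) (circlepath c R)"

definition boundary_integral ::
    "(complex \<Rightarrow> complex) \<Rightarrow> complex \<Rightarrow> real \<Rightarrow> complex \<times> complex \<Rightarrow> complex ^ 2" where
  "boundary_integral f c R Q =
     vec_integral (restrict_to (cball c R) f) (rectpath (fst Q) (snd Q)) +
     vec_integral (restrict_to (cbox (fst Q) (snd Q)) f) (circlepath c R)"

section \<open>The absolute integral sum of residues\<close>

text \<open>
  The sum of the residues over all points is not a series formed from the residues at the
  individual points: these may all vanish while the total, like that of an integral, does not. It is,
  as a whole, the limit of the sums of the cell boundary integrals, divided by \<open>2 \<pi> \<i>\<close>, as the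
  cells shrink to points; for the whole plane it is the limit of the values for the discs. The
  sequence \<open>D\<close> (for the plane, one sequence \<open>D R\<close> for each radius) consists of the subdivisions
  used; \<open>f\<close> need only be integrable on the boundaries of their cells.
\<close>

definition has_disc_residue_sum ::
    "(complex \<Rightarrow> complex) \<Rightarrow> complex \<Rightarrow> real \<Rightarrow> (nat \<Rightarrow> real set \<times> real set) \<Rightarrow> complex ^ 2 \<Rightarrow> bool" where
  "has_disc_residue_sum f c R D S \<longleftrightarrow>
     refining_subdivisions c R D \<and>
     (\<forall>n. \<forall>Q \<in> rectangles c R (D n). boundary_integrable f c R Q) \<and>
     (\<lambda>n. \<Sum>Q \<in> rectangles c R (D n). (1 / (2 * of_real pi * \<i>)) *s boundary_integral f c R Q)
       \<longlonglongrightarrow> S"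

definition has_plane_residue_sum ::
    "(complex \<Rightarrow> complex) \<Rightarrow> complex \<Rightarrow> (real \<Rightarrow> nat \<Rightarrow> real set \<times> real set) \<Rightarrow> complex ^ 2 \<Rightarrow> bool" where
  "has_plane_residue_sum f c D S \<longleftrightarrow>
     (\<exists>T. (\<forall>\<^sub>F R in at_top. has_disc_residue_sum f c R (D R) (T R)) \<and> (T \<longlongrightarrow> S) at_top)"

section \<open>Sectors and the arc at infinity\<close>

definition sector :: "complex \<Rightarrow> real \<Rightarrow> real \<Rightarrow> complex set" where
  "sector c \<phi>1 \<phi>2 = {c + of_real r * cis \<phi> | r \<phi>. r > 0 \<and> \<phi>1 < \<phi> \<and> \<phi> < \<phi>2}"

text \<open>The arc lies outside \<^term>\<open>sector c \<phi>1 \<phi>2\<close>: it runs from the angle \<open>\<phi>2\<close> to \<open>\<phi>1 + 2 \<pi>\<close>.\<close>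

definition has_exterior_integral ::
    "(complex \<Rightarrow> complex) \<Rightarrow> complex \<Rightarrow> real \<Rightarrow> real \<Rightarrow> complex ^ 2 \<Rightarrow> bool" where
  "has_exterior_integral f c \<phi>1 \<phi>2 V \<longleftrightarrow>
     (\<forall>\<^sub>F R in at_top. vec_integrable f (part_circlepath c R \<phi>2 (\<phi>1 + 2 * pi))) \<and>
     ((\<lambda>R. vec_integral f (part_circlepath c R \<phi>2 (\<phi>1 + 2 * pi))) \<longlongrightarrow> V) at_top"

end

theory Submission
  imports Defs
begin

text \<open>
  In the sum over the cells every interior edge is traversed once in each direction, and the tangents
  of the circle meet the disc in single points; so the sum over each subdivision of the disc equals
  the integral over its circle, and the residue sum of the plane is the limit of the circle integrals
  divided by \<open>2 \<pi> \<i>\<close>. On the arc inside the sector the integrand tends uniformly to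
  \<open>\<i> A d\<phi>\<close>, since \<open>d\<zeta> = \<i> \<zeta> d\<phi>\<close> and \<open>d (cnj \<zeta>) = - \<i> cnj \<zeta> d\<phi>\<close>; what is
  left is the arc outside. Each step is carried out for ordinary contour integrals and applied to
  \<open>f\<close> and to its conjugate.
\<close>

section \<open>The two components of the vector integral\<close>

text \<open>Conjugation commutes with the integral and turns \<open>f * cnj \<gamma>'\<close> into
  \<open>cnj f * \<gamma>'\<close>. This makes the library of contour integrals available for the
  conjugate differential.\<close>

lemma has_conj_integral_iff:
  "has_conj_integral f I \<gamma> \<longleftrightarrow> ((cnj \<circ> f) has_contour_integral cnj I) \<gamma>"
  unfolding has_conj_integral_def has_contour_integral_def
  by (subst has_integral_cnj[symmetric]) (simp add: o_def)

lemma has_vec_integral_iff: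
  "has_vec_integral f V \<gamma> \<longleftrightarrow>
     ((cnj \<circ> f) has_contour_integral cnj (V $ 1)) \<gamma> \<and> (f has_contour_integral V $ 2) \<gamma>"
proof -
  have "V = I *s w1 + J *s w2 \<longleftrightarrow> I = V $ 1 \<and> J = V $ 2" for I J
    by (auto simp: vec_eq_iff forall_2 w1_def w2_def axis_def)
  then show ?thesis
    by (auto simp: has_vec_integral_def has_conj_integral_iff)
qed

lemma vec_integrable_iff:
  "vec_integrable f \<gamma> \<longleftrightarrow> (cnj \<circ> f) contour_integrable_on \<gamma> \<and> f contour_integrable_on \<gamma>"
proof
  assume R: "(cnj \<circ> f) contour_integrable_on \<gamma> \<and> f contour_integrable_on \<gamma>"
  define V :: "complex ^ 2" where
    "V = vector [cnj (contour_integral \<gamma> (cnj \<circ> f)), contour_integral \<gamma> f]"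
  have "has_vec_integral f V \<gamma>"
    using R by (simp add: has_vec_integral_iff V_def has_contour_integral_integral)
  then show "vec_integrable f \<gamma>"
    by (auto simp: vec_integrable_def)
qed (auto simp: vec_integrable_def has_vec_integral_iff contour_integrable_on_def)

text \<open>Uniqueness of contour integrals shows that the definite description in
  \<open>vec_integral\<close> denotes as soon as some value exists.\<close>

lemma vec_integral_nth:
  assumes "vec_integrable f \<gamma>"
  shows "vec_integral f \<gamma> $ 1 = cnj (contour_integral \<gamma> (cnj \<circ> f))"
    and "vec_integral f \<gamma> $ 2 = contour_integral \<gamma> f"
proof -
  obtain V where V: "has_vec_integral f V \<gamma>"
    using assms by (auto simp: vec_integrable_def)
  have nth: "(W :: complex ^ 2) $ 1 = cnj (contour_integral \<gamma> (cnj \<circ> f)) \<and> W $ 2 = contour_integral \<gamma> f"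
    if "has_vec_integral f W \<gamma>" for W
    using that by (auto simp: has_vec_integral_iff dest!: contour_integral_unique)
  have "vec_integral f \<gamma> = V"
    unfolding vec_integral_def
    by (rule the_equality[of _ V]) (use nth V in \<open>auto simp: vec_eq_iff forall_2\<close>)
  with nth[OF V] show "vec_integral f \<gamma> $ 1 = cnj (contour_integral \<gamma> (cnj \<circ> f))"
    and "vec_integral f \<gamma> $ 2 = contour_integral \<gamma> f"
    by auto
qed

section \<open>Sums over the rectangles of a grid\<close>

text \<open>The one-dimensional factor of \<open>rectangles\<close>: with it, a sum over the grid
  becomes an iterated sum, and each direction can telescope by itself.\<close>

definition gaps :: "real set \<Rightarrow> (real \<times> real) set" where
  "gaps X = {(s, t). consecutive X s t}"

lemma finite_gaps: "finite X \<Longrightarrow> finite (gaps X)"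
  by (rule finite_subset[of _ "X \<times> X"]) (auto simp: gaps_def consecutive_def)

text \<open>A point above all others breaks no existing gap and creates a single new one, next to
  the old maximum. This is the induction step for telescoping.\<close>

lemma gaps_insert_max:
  assumes "finite X" "X \<noteq> {}" "\<forall>x\<in>X. x < b"
  shows "gaps (insert b X) = insert (Max X, b) (gaps X)"
proof -
  have M: "Max X \<in> X" "\<And>x. x \<in> X \<Longrightarrow> x \<le> Max X"
    using assms by auto
  have "consecutive (insert b X) s t \<longleftrightarrow> (s = Max X \<and> t = b) \<or> consecutive X s t" for s t
  proof
    assume *: "consecutive (insert b X) s t"
    show "(s = Max X \<and> t = b) \<or> consecutive X s t"
    proof (cases "t = b")
      case True
      \<comment> \<open>If \<open>s\<close> were below \<open>Max X\<close>, then
        \<open>Max X\<close> would lie strictly between \<open>s\<close> and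
        \<open>b\<close>.\<close>
      with * have "s \<in> X" "\<not> s < Max X"
        using M assms(3) by (auto simp: consecutive_def)
      with M(2) have "s = Max X"
        by force
      with True show ?thesis by simp
    next
      case False
      with * assms(3) show ?thesis
        by (auto simp: consecutive_def)
    qed
  next
    assume "(s = Max X \<and> t = b) \<or> consecutive X s t"
    then show "consecutive (insert b X) s t"
      using M assms(3) by (auto simp: consecutive_def not_less dest: order.strict_trans) force+
  qed
  then show ?thesis
    by (auto simp: gaps_def)
qed

text \<open>Telescoping, by induction on inserting ever larger points. It serves twice: to cancel
  interior edges, and to count the gaps that contain a given number.\<close>

lemma sum_gaps:
  fixes h :: "real \<Rightarrow> 'a::ab_group_add"
  assumes "finite X" "X \<noteq> {}"
  shows "(\<Sum>(s, t) \<in> gaps X. h t - h s) = h (Max X) - h (Min X)"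
  using assms
proof (induction X rule: finite_linorder_max_induct)
  case (insert b X)
  show ?case
  proof (cases "X = {}")
    case True
    then have "gaps (insert b X) = {}"
      by (auto simp: gaps_def consecutive_def)
    with True show ?thesis
      by simp
  next
    case False
    have "Min X < b" "Max X < b"
      using insert.hyps False by (meson Min_in Max_in)+
    then have "Max (insert b X) = b" "Min (insert b X) = Min X"
      unfolding Max_insert[OF insert.hyps(1) False] Min_insert[OF insert.hyps(1) False]
      by linarith+
    moreover have "(Max X, b) \<notin> gaps X"
      using insert.hyps by (auto simp: gaps_def consecutive_def)
    ultimately show ?thesis
      using insert False by (simp add: gaps_insert_max finite_gaps)
  qed
qed simp

definition abscissae :: "complex \<Rightarrow> real \<Rightarrow> real set \<times> real set \<Rightarrow> real set" where
  "abscissae c R D = fst D \<union> {Re c - R, Re c + R}"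

definition ordinates :: "complex \<Rightarrow> real \<Rightarrow> real set \<times> real set \<Rightarrow> real set" where
  "ordinates c R D = snd D \<union> {Im c - R, Im c + R}"

text \<open>The corners mix the two gaps: \<open>(s, t)\<close> holds the abscissae and
  \<open>(u, v)\<close> the ordinates of the lower left and upper right corner.\<close>

lemma bij_betw_rectangles:
  "bij_betw (\<lambda>((s, t), (u, v)). (Complex s u, Complex t v))
     (gaps (abscissae c R D) \<times> gaps (ordinates c R D)) (rectangles c R D)"
  by (rule bij_betwI[where g = "\<lambda>(a, b). ((Re a, Re b), (Im a, Im b))"])
    (auto simp: gaps_def rectangles_def abscissae_def ordinates_def)

lemma sum_rectangles:
  "(\<Sum>Q \<in> rectangles c R D. F Q) =
     (\<Sum>(s, t) \<in> gaps (abscissae c R D). \<Sum>(u, v) \<in> gaps (ordinates c R D).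
        F (Complex s u, Complex t v))"
  by (subst sum.reindex_bij_betw[OF bij_betw_rectangles, symmetric])
    (simp add: sum.cartesian_product case_prod_unfold)

lemma rectangles_iff_gaps:
  "(Complex s u, Complex t v) \<in> rectangles c R D \<longleftrightarrow>
     (s, t) \<in> gaps (abscissae c R D) \<and> (u, v) \<in> gaps (ordinates c R D)"
  by (simp add: gaps_def rectangles_def abscissae_def ordinates_def)

lemma abscissae_props:
  assumes "subdivision c R D" "R > 0"
  shows "finite (abscissae c R D)" "abscissae c R D \<noteq> {}"
    "Min (abscissae c R D) = Re c - R" "Max (abscissae c R D) = Re c + R"
proof -
  show fin: "finite (abscissae c R D)" and "abscissae c R D \<noteq> {}"
    using assms by (auto simp: abscissae_def subdivision_def)
  show "Min (abscissae c R D) = Re c - R"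
    by (rule Min_eqI[OF fin]) (use assms in \<open>auto simp: abscissae_def subdivision_def\<close>)
  show "Max (abscissae c R D) = Re c + R"
    by (rule Max_eqI[OF fin]) (use assms in \<open>auto simp: abscissae_def subdivision_def\<close>)
qed

lemma ordinates_props:
  assumes "subdivision c R D" "R > 0"
  shows "finite (ordinates c R D)" "ordinates c R D \<noteq> {}"
    "Min (ordinates c R D) = Im c - R" "Max (ordinates c R D) = Im c + R"
proof -
  show fin: "finite (ordinates c R D)" and "ordinates c R D \<noteq> {}"
    using assms by (auto simp: ordinates_def subdivision_def)
  show "Min (ordinates c R D) = Im c - R"
    by (rule Min_eqI[OF fin]) (use assms in \<open>auto simp: ordinates_def subdivision_def\<close>)
  show "Max (ordinates c R D) = Im c + R"
    by (rule Max_eqI[OF fin]) (use assms in \<open>auto simp: ordinates_def subdivision_def\<close>)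
qed

section \<open>Cancellation of the interior edges\<close>

text \<open>Reversing the top and left sides orients opposite sides alike. The result, right minus
  left less top minus bottom, consists of two differences that telescope over the grid.\<close>

lemma contour_integral_rectpath:
  assumes "g contour_integrable_on rectpath (Complex s u) (Complex t v)"
  shows "contour_integral (rectpath (Complex s u) (Complex t v)) g =
           (contour_integral (linepath (Complex t u) (Complex t v)) g -
            contour_integral (linepath (Complex s u) (Complex s v)) g) -
           (contour_integral (linepath (Complex s v) (Complex t v)) g -
            contour_integral (linepath (Complex s u) (Complex t u)) g)"
proof -
  have rev: "contour_integral (linepath b a) g = - contour_integral (linepath a b) g" for a b
    using contour_integral_reversepath[of "linepath a b" g] by simp
  show ?thesis
    using assms rev[of "Complex t v" "Complex s v"] rev[of "Complex s v" "Complex s u"]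
    by (simp add: rectpath_def Let_def)
qed

text \<open>As \<open>linepath a b\<close> is injective for distinct ends, only finitely many
  parameters hit \<open>K\<close>, and changing an integrand at finitely many parameters leaves its
  integral alone.\<close>

lemma contour_integral_linepath_eq_0:
  assumes "a \<noteq> b" "finite K" "\<And>z. z \<in> closed_segment a b - K \<Longrightarrow> g z = 0"
  shows "contour_integral (linepath a b) g = 0"
proof -
  have fin: "finite (linepath a b -` K \<inter> {0..1})"
    by (rule finite_vimage_IntI[OF assms(2) inj_on_linepath[OF assms(1)]])
  have zero: "g (linepath a b t) * (b - a) = 0" if "t \<in> {0..1} - (linepath a b -` K \<inter> {0..1})" for t
  proof -
    have "linepath a b t \<in> closed_segment a b - K"
      using that linepath_in_path[of t a b] by blast
    then show ?thesis
      by (simp add: assms(3))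
  qed
  have "((\<lambda>t. g (linepath a b t) * (b - a)) has_integral 0) {0..1}"
    by (rule has_integral_spike_finite[OF fin zero has_integral_0])
  then have "(g has_contour_integral 0) (linepath a b)"
    by (simp add: has_contour_integral_linepath)
  then show ?thesis
    by (rule contour_integral_unique)
qed

text \<open>By Pythagoras, a vertical offset of size \<open>R\<close> leaves no room for a
  horizontal one: a horizontal tangent touches the disc only at the point of tangency.\<close>

lemma cball_Im_tangent:
  assumes "z \<in> cball c R" "\<bar>Im z - Im c\<bar> = R"
  shows "z = Complex (Re c) (Im z)"
proof -
  have "(Re (z - c))\<^sup>2 + (Im (z - c))\<^sup>2 \<le> R\<^sup>2"
    using power_mono[of "cmod (z - c)" R 2] assms(1)
    by (simp only: cmod_power2) (simp add: dist_norm norm_minus_commute)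
  moreover have "(Im (z - c))\<^sup>2 = R\<^sup>2"
    using assms(2) by (metis minus_complex.simps(2) power2_abs)
  ultimately have "Re z = Re c"
    by simp
  then show ?thesis
    by (simp add: complex_eq_iff)
qed

lemma cball_Re_tangent:
  assumes "z \<in> cball c R" "\<bar>Re z - Re c\<bar> = R"
  shows "z = Complex (Re z) (Im c)"
proof -
  have "(Re (z - c))\<^sup>2 + (Im (z - c))\<^sup>2 \<le> R\<^sup>2"
    using power_mono[of "cmod (z - c)" R 2] assms(1)
    by (simp only: cmod_power2) (simp add: dist_norm norm_minus_commute)
  moreover have "(Re (z - c))\<^sup>2 = R\<^sup>2"
    using assms(2) by (metis minus_complex.simps(1) power2_abs)
  ultimately have "Im z = Im c"
    by simp
  then show ?thesis
    by (simp add: complex_eq_iff)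
qed

lemma Im_closed_segment_horizontal:
  "z \<in> closed_segment (Complex s y) (Complex t y) \<Longrightarrow> Im z = y"
  by (auto simp: in_segment) (simp flip: distrib_right)

lemma Re_closed_segment_vertical:
  "z \<in> closed_segment (Complex x u) (Complex x v) \<Longrightarrow> Re z = x"
  by (auto simp: in_segment) (simp flip: distrib_right)

text \<open>Restricted to the disc, the integrand vanishes along the tangent except possibly at the
  point of contact.\<close>

lemma contour_integral_horizontal_tangent:
  assumes "s < t" "\<bar>y - Im c\<bar> = R"
  shows "contour_integral (linepath (Complex s y) (Complex t y)) (restrict_to (cball c R) g) = 0"
  using assms cball_Im_tangent[of _ c R]
  by (intro contour_integral_linepath_eq_0[where K = "{Complex (Re c) y}"])
    (auto simp: restrict_to_def dest!: Im_closed_segment_horizontal)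

lemma contour_integral_vertical_tangent:
  assumes "u < v" "\<bar>x - Re c\<bar> = R"
  shows "contour_integral (linepath (Complex x u) (Complex x v)) (restrict_to (cball c R) g) = 0"
  using assms cball_Re_tangent[of _ c R]
  by (intro contour_integral_linepath_eq_0[where K = "{Complex x (Im c)}"])
    (auto simp: restrict_to_def dest!: Re_closed_segment_vertical)

text \<open>Horizontal edges telescope within each column and vertical edges within each row. What
  survives lies on the four tangents, where the integrals are 0.\<close>

lemma sum_rectpath_integrals:
  assumes sub: "subdivision c R D" "R > 0"
    and int: "\<And>Q. Q \<in> rectangles c R D \<Longrightarrow>
      restrict_to (cball c R) g contour_integrable_on rectpath (fst Q) (snd Q)"
  shows "(\<Sum>Q \<in> rectangles c R D.
           contour_integral (rectpath (fst Q) (snd Q)) (restrict_to (cball c R) g)) = 0"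
proof -
  define H where "H s t y = contour_integral (linepath (Complex s y) (Complex t y))
    (restrict_to (cball c R) g)" for s t y
  define V where "V u v x = contour_integral (linepath (Complex x u) (Complex x v))
    (restrict_to (cball c R) g)" for u v x
  let ?X = "abscissae c R D" and ?Y = "ordinates c R D"
  note X = abscissae_props[OF sub] and Y = ordinates_props[OF sub]
  have 1: "(\<Sum>(u, v) \<in> gaps ?Y. H s t v - H s t u) = 0" if "(s, t) \<in> gaps ?X" for s t
    using that \<open>R > 0\<close> unfolding sum_gaps[of ?Y "H s t", OF Y(1,2)]
    by (simp add: Y H_def gaps_def consecutive_def contour_integral_horizontal_tangent)
  have 2: "(\<Sum>(s, t) \<in> gaps ?X. V u v t - V u v s) = 0" if "(u, v) \<in> gaps ?Y" for u v
    using that \<open>R > 0\<close> unfolding sum_gaps[of ?X "V u v", OF X(1,2)]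
    by (simp add: X V_def gaps_def consecutive_def contour_integral_vertical_tangent)
  have "(\<Sum>Q \<in> rectangles c R D.
           contour_integral (rectpath (fst Q) (snd Q)) (restrict_to (cball c R) g)) =
        (\<Sum>(s, t) \<in> gaps ?X. \<Sum>(u, v) \<in> gaps ?Y.
           (V u v t - V u v s) - (H s t v - H s t u))"
    unfolding sum_rectangles
    by (intro sum.cong)
      (auto simp: V_def H_def rectangles_iff_gaps
        intro!: sum.cong contour_integral_rectpath int[of "(_, _)", simplified])
  also have "\<dots> = (\<Sum>(u, v) \<in> gaps ?Y. \<Sum>(s, t) \<in> gaps ?X. V u v t - V u v s) -
                  (\<Sum>(s, t) \<in> gaps ?X. \<Sum>(u, v) \<in> gaps ?Y. H s t v - H s t u)"
    \<comment> \<open>Only the vertical edges need the order of summation exchanged, since they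
      telescope over the abscissae.\<close>
    by (simp add: case_prod_unfold sum_subtractf sum.swap[of _ "gaps ?Y"])
  also have "\<dots> = 0"
    using 1 2 by (simp add: case_prod_unfold)
  finally show ?thesis .
qed

section \<open>Reassembling the circle\<close>

text \<open>For \<open>x\<close> outside \<open>X\<close>, the indicator of the closed gap from
  \<open>s\<close> to \<open>t\<close> at \<open>x\<close> is the increment between \<open>s\<close>
  and \<open>t\<close> of the step function that jumps at \<open>x\<close>, so the sum
  telescopes.\<close>

lemma sum_gaps_indicator:
  assumes "finite X" "X \<noteq> {}" "x \<notin> X" "Min X < x" "x < Max X"
  shows "(\<Sum>(s, t) \<in> gaps X. of_bool (s \<le> x \<and> x \<le> t)) = (1::complex)"
proof -
  have "(\<Sum>(s, t) \<in> gaps X. of_bool (s \<le> x \<and> x \<le> t)) =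
        (\<Sum>(s, t) \<in> gaps X. of_bool (x \<le> t) - of_bool (x \<le> s) :: complex)"
    using assms(3) by (intro sum.cong) (force simp: gaps_def consecutive_def of_bool_def)+
  also have "\<dots> = of_bool (x \<le> Max X) - of_bool (x \<le> Min X)"
    by (rule sum_gaps[OF assms(1,2)])
  finally show ?thesis
    using assms(4,5) by (simp del: Min_less_iff Max_gr_iff Min_le_iff Max_ge_iff)
qed

text \<open>A vertical line meets the circle in at most two points, found by solving the equation of
  the circle for the ordinate. Together with the horizontal analogue this makes the crossings of
  circle and grid negligible.\<close>

lemma finite_sphere_Re: "finite {z \<in> sphere c R. Re z = x}"
proof (rule finite_subset)
  let ?d = "sqrt (R\<^sup>2 - (x - Re c)\<^sup>2)"
  show "{z \<in> sphere c R. Re z = x} \<subseteq> {Complex x (Im c + ?d), Complex x (Im c - ?d)}"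
  proof
    fix z assume z: "z \<in> {z \<in> sphere c R. Re z = x}"
    then have "cmod (z - c) = R"
      by (simp add: dist_norm norm_minus_commute)
    then have "(Re (z - c))\<^sup>2 + (Im (z - c))\<^sup>2 = R\<^sup>2"
      by (metis cmod_power2)
    with z have "(Im z - Im c)\<^sup>2 = R\<^sup>2 - (x - Re c)\<^sup>2"
      by simp
    then have "\<bar>Im z - Im c\<bar> = ?d"
      by (metis real_sqrt_abs)
    then have "Im z = Im c + ?d \<or> Im z = Im c - ?d"
      by arith
    with z show "z \<in> {Complex x (Im c + ?d), Complex x (Im c - ?d)}"
      by (auto simp: complex_eq_iff)
  qed
qed simp

lemma finite_sphere_Im: "finite {z \<in> sphere c R. Im z = y}"
proof (rule finite_subset)
  let ?d = "sqrt (R\<^sup>2 - (y - Im c)\<^sup>2)"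
  show "{z \<in> sphere c R. Im z = y} \<subseteq> {Complex (Re c + ?d) y, Complex (Re c - ?d) y}"
  proof
    fix z assume z: "z \<in> {z \<in> sphere c R. Im z = y}"
    then have "cmod (z - c) = R"
      by (simp add: dist_norm norm_minus_commute)
    then have "(Re (z - c))\<^sup>2 + (Im (z - c))\<^sup>2 = R\<^sup>2"
      by (metis cmod_power2)
    with z have "(Re z - Re c)\<^sup>2 = R\<^sup>2 - (y - Im c)\<^sup>2"
      by simp
    then have "\<bar>Re z - Re c\<bar> = ?d"
      by (metis real_sqrt_abs)
    then have "Re z = Re c + ?d \<or> Re z = Re c - ?d"
      by arith
    with z show "z \<in> {Complex (Re c + ?d) y, Complex (Re c - ?d) y}"
      by (auto simp: complex_eq_iff)
  qed
qed simp

text \<open>The indicator of a rectangle is a product of indicators of two gaps, so the double sum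
  factors into two sums that are both 1.\<close>

lemma sum_restrict_to_rectangles:
  assumes sub: "subdivision c R D" "R > 0" and z: "z \<in> sphere c R"
    and "Re z \<notin> abscissae c R D" "Im z \<notin> ordinates c R D"
  shows "(\<Sum>Q \<in> rectangles c R D. restrict_to (cbox (fst Q) (snd Q)) g z) = g z"
proof -
  let ?X = "abscissae c R D" and ?Y = "ordinates c R D"
  have "\<bar>Re z - Re c\<bar> \<le> R" "\<bar>Im z - Im c\<bar> \<le> R"
    using z abs_Re_le_cmod[of "z - c"] abs_Im_le_cmod[of "z - c"]
    by (auto simp: dist_norm norm_minus_commute)
  \<comment> \<open>The tangents belong to the grid, so avoiding grid lines makes the inequalities
    strict.\<close>
  with assms have "Re c - R < Re z" "Re z < Re c + R" "Im c - R < Im z" "Im z < Im c + R"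
    by (auto simp: abscissae_def ordinates_def abs_le_iff less_le)
  then have ind: "(\<Sum>(s, t) \<in> gaps ?X. of_bool (s \<le> Re z \<and> Re z \<le> t)) = (1::complex)"
    "(\<Sum>(u, v) \<in> gaps ?Y. of_bool (u \<le> Im z \<and> Im z \<le> v)) = (1::complex)"
    using assms abscissae_props[OF sub] ordinates_props[OF sub]
    by (auto intro!: sum_gaps_indicator)
  have "(\<Sum>Q \<in> rectangles c R D. restrict_to (cbox (fst Q) (snd Q)) g z) =
        (\<Sum>(s, t) \<in> gaps ?X. \<Sum>(u, v) \<in> gaps ?Y.
           of_bool (s \<le> Re z \<and> Re z \<le> t) * (of_bool (u \<le> Im z \<and> Im z \<le> v) * g z))"
    unfolding sum_rectangles
    by (intro sum.cong) (auto simp: restrict_to_def in_cbox_complex_iff intro!: sum.cong)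
  also have "\<dots> = (\<Sum>(s, t) \<in> gaps ?X. of_bool (s \<le> Re z \<and> Re z \<le> t)) *
                  ((\<Sum>(u, v) \<in> gaps ?Y. of_bool (u \<le> Im z \<and> Im z \<le> v)) * g z)"
    by (simp add: case_prod_unfold sum_distrib_left sum_distrib_right sum.swap[of _ "gaps ?Y"])
  finally show ?thesis
    by (simp add: ind)
qed

text \<open>On the circle the restrictions of \<open>g\<close> add up to \<open>g\<close> away from
  the grid lines, and the circle meets these in finitely many points only.\<close>

lemma sum_circlepath_integrals:
  assumes sub: "subdivision c R D" "R > 0"
    and g: "g contour_integrable_on circlepath c R"
    and int: "\<And>Q. Q \<in> rectangles c R D \<Longrightarrow>
      restrict_to (cbox (fst Q) (snd Q)) g contour_integrable_on circlepath c R"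
  shows "(\<Sum>Q \<in> rectangles c R D.
           contour_integral (circlepath c R) (restrict_to (cbox (fst Q) (snd Q)) g)) =
         contour_integral (circlepath c R) g" (is "?S = ?I")
proof -
  let ?X = "abscissae c R D" and ?Y = "ordinates c R D"
  have fin: "finite ?X" "finite ?Y"
    by (rule abscissae_props[OF sub] ordinates_props[OF sub])+
  \<comment> \<open>The exceptional points: the rectangles are closed, so a point on a grid line may
    be counted more than once.\<close>
  define K where
    "K = (\<Union>x\<in>?X. {z \<in> sphere c R. Re z = x}) \<union> (\<Union>y\<in>?Y. {z \<in> sphere c R. Im z = y})"
  have "finite (rectangles c R D)"
    using bij_betw_finite[OF bij_betw_rectangles[of c R D]] fin by (simp add: finite_gaps)
  then have diff: "((\<lambda>z. (\<Sum>Q \<in> rectangles c R D. restrict_to (cbox (fst Q) (snd Q)) g z) - g z)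
          has_contour_integral (?S - ?I)) (part_circlepath c R 0 (2 * pi))"
    using g int
    by (intro has_contour_integral_diff has_contour_integral_sum)
      (auto simp: circlepath_def intro!: has_contour_integral_integral)
  have "finite K"
    unfolding K_def by (intro finite_UnI finite_UN_I fin finite_sphere_Re finite_sphere_Im)
  have zero: "cmod ((\<Sum>Q \<in> rectangles c R D. restrict_to (cbox (fst Q) (snd Q)) g z) - g z) \<le> 0"
    if "z \<in> path_image (part_circlepath c R 0 (2 * pi)) - K" for z
  proof -
    have "z \<in> sphere c R"
      using that \<open>R > 0\<close> by (auto simp flip: circlepath_def)
    with that show ?thesis
      by (subst sum_restrict_to_rectangles[OF sub]) (auto simp: K_def)
  qed
  \<comment> \<open>The length estimate with bound 0 off \<open>K\<close> forces equality.\<close>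
  have "cmod (?S - ?I) \<le> 0 * R * (2 * pi - 0)"
    by (rule has_contour_integral_bound_part_circlepath_strong[OF diff \<open>finite K\<close> order_refl \<open>R > 0\<close> _ zero])
      simp_all
  then show ?thesis
    by simp
qed

lemma cnj_comp_restrict_to: "cnj \<circ> restrict_to S f = restrict_to S (cnj \<circ> f)"
  by (auto simp: restrict_to_def)

lemma sum_boundary_integrals:
  assumes sub: "subdivision c R D" "R > 0"
    and f: "vec_integrable f (circlepath c R)"
    and int: "\<And>Q. Q \<in> rectangles c R D \<Longrightarrow> boundary_integrable f c R Q"
  shows "(\<Sum>Q \<in> rectangles c R D. boundary_integral f c R Q) = vec_integral f (circlepath c R)"
proof -
  note int' = int[unfolded boundary_integrable_def]
  have "(\<Sum>Q \<in> rectangles c R D. boundary_integral f c R Q $ 1) =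
      cnj ((\<Sum>Q \<in> rectangles c R D.
         contour_integral (rectpath (fst Q) (snd Q)) (restrict_to (cball c R) (cnj \<circ> f))) +
       (\<Sum>Q \<in> rectangles c R D.
         contour_integral (circlepath c R) (restrict_to (cbox (fst Q) (snd Q)) (cnj \<circ> f))))"
    using int'
    by (simp add: boundary_integral_def vec_integral_nth cnj_comp_restrict_to sum.distrib)
  also have "\<dots> = cnj (contour_integral (circlepath c R) (cnj \<circ> f))"
    using f int'
    by (subst sum_rectpath_integrals[OF sub], simp add: vec_integrable_iff cnj_comp_restrict_to,
        subst sum_circlepath_integrals[OF sub])
      (auto simp: vec_integrable_iff cnj_comp_restrict_to)
  finally have 1: "(\<Sum>Q \<in> rectangles c R D. boundary_integral f c R Q $ 1) =
      vec_integral f (circlepath c R) $ 1"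
    by (simp add: vec_integral_nth f)
  have "(\<Sum>Q \<in> rectangles c R D. boundary_integral f c R Q $ 2) =
      (\<Sum>Q \<in> rectangles c R D.
         contour_integral (rectpath (fst Q) (snd Q)) (restrict_to (cball c R) f)) +
      (\<Sum>Q \<in> rectangles c R D.
         contour_integral (circlepath c R) (restrict_to (cbox (fst Q) (snd Q)) f))"
    using int' by (simp add: boundary_integral_def vec_integral_nth sum.distrib)
  also have "\<dots> = contour_integral (circlepath c R) f"
    using f int'
    by (subst sum_rectpath_integrals[OF sub], simp add: vec_integrable_iff,
        subst sum_circlepath_integrals[OF sub]) (auto simp: vec_integrable_iff)
  finally have 2: "(\<Sum>Q \<in> rectangles c R D. boundary_integral f c R Q $ 2) =
      vec_integral f (circlepath c R) $ 2"
    by (simp add: vec_integral_nth f)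
  show ?thesis
    using 1 2 by (simp add: vec_eq_iff forall_2)
qed

text \<open>The sum over the cells is the same for every subdivision, so the defining limit is that
  of a constant sequence.\<close>

lemma disc_residue_sum_eq:
  assumes "has_disc_residue_sum f c R D S" "R > 0" "vec_integrable f (circlepath c R)"
  shows "vec_integral f (circlepath c R) = (2 * of_real pi * \<i>) *s S"
proof -
  have sub: "subdivision c R (D n)" and
    int: "\<And>Q. Q \<in> rectangles c R (D n) \<Longrightarrow> boundary_integrable f c R Q" for n
    using assms(1) by (auto simp: has_disc_residue_sum_def refining_subdivisions_def)
  have "(\<lambda>n. \<Sum>Q \<in> rectangles c R (D n). (1 / (2 * of_real pi * \<i>)) *s boundary_integral f c R Q)
      \<longlonglongrightarrow> S"
    using assms(1) by (simp add: has_disc_residue_sum_def)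
  then have "(\<lambda>n::nat. (1 / (2 * of_real pi * \<i>)) *s vec_integral f (circlepath c R)) \<longlonglongrightarrow> S"
    using sum_boundary_integrals[OF sub assms(2,3) int]
    by (simp only: vec.scale_sum_right[symmetric])
  then have "S = (1 / (2 * of_real pi * \<i>)) *s vec_integral f (circlepath c R)"
    by (simp add: LIMSEQ_const_iff)
  then show ?thesis
    by (simp add: vec_eq_iff)
qed

section \<open>Splitting the circle into two arcs\<close>

text \<open>The outer arc runs past the angle \<open>2 * pi\<close>. By periodicity its last piece
  is the initial piece of the circle, with angles from 0 to \<open>\<phi>1\<close>, shifted by a
  full turn.\<close>

lemma circlepath_split:
  assumes g: "g contour_integrable_on circlepath c R"
    and "0 \<le> \<phi>1" "\<phi>1 < \<phi>2" "\<phi>2 < 2 * pi"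
  shows "g contour_integrable_on part_circlepath c R \<phi>1 \<phi>2"
    and "g contour_integrable_on part_circlepath c R \<phi>2 (\<phi>1 + 2 * pi)"
    and "contour_integral (circlepath c R) g =
           contour_integral (part_circlepath c R \<phi>1 \<phi>2) g +
           contour_integral (part_circlepath c R \<phi>2 (\<phi>1 + 2 * pi)) g"
proof -
  \<comment> \<open>The integrand in terms of the angle, common to the circle and both arcs.\<close>
  define h where "h t = g (c + R * cis t) * R * \<i> * cis t" for t
  have h: "h integrable_on {0..2*pi}"
    using g unfolding circlepath_def h_def by (subst (asm) contour_integrable_part_circlepath_iff) auto
  have sub: "h integrable_on {a..b}" if "0 \<le> a" "b \<le> 2 * pi" for a b
    using that by (intro integrable_on_subinterval[OF h]) auto
  have per: "h (t - 2 * pi) = h t" for t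
    by (simp add: h_def cis_divide[of t "2 * pi", symmetric])
  have "(h has_integral integral {0..\<phi>1} h) {0..\<phi>1}"
    using sub[of 0 \<phi>1] assms by (simp add: has_integral_integral[symmetric])
  from has_integral_shift_real_ivl[OF this, of "- (2 * pi)"]
  have shift: "(h has_integral integral {0..\<phi>1} h) {2*pi..\<phi>1 + 2*pi}"
    by (simp add: per)
  have whole: "(h has_integral (integral {0..\<phi>1} h + integral {\<phi>1..\<phi>2} h + integral {\<phi>2..2*pi} h)) {0..2*pi}"
    using assms sub
    by (intro has_integral_combine[of 0 \<phi>2 "2*pi"] has_integral_combine[of 0 \<phi>1 \<phi>2])
      (auto simp: has_integral_integral[symmetric])
  have inner: "(h has_integral integral {\<phi>1..\<phi>2} h) {\<phi>1..\<phi>2}"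
    using sub[of \<phi>1 \<phi>2] assms by (simp add: has_integral_integral[symmetric])
  have outer: "(h has_integral (integral {\<phi>2..2*pi} h + integral {0..\<phi>1} h)) {\<phi>2..\<phi>1 + 2*pi}"
    using assms sub[of \<phi>2 "2*pi"]
    by (intro has_integral_combine[OF _ _ _ shift]) (auto simp: has_integral_integral[symmetric])
  have W: "(g has_contour_integral (integral {0..\<phi>1} h + integral {\<phi>1..\<phi>2} h + integral {\<phi>2..2*pi} h))
      (circlepath c R)"
    using whole unfolding circlepath_def h_def by (subst has_contour_integral_part_circlepath_iff) auto
  have I: "(g has_contour_integral integral {\<phi>1..\<phi>2} h) (part_circlepath c R \<phi>1 \<phi>2)"
    using inner assms unfolding h_def by (subst has_contour_integral_part_circlepath_iff) auto
  have O: "(g has_contour_integral (integral {\<phi>2..2*pi} h + integral {0..\<phi>1} h))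
      (part_circlepath c R \<phi>2 (\<phi>1 + 2 * pi))"
    using outer assms unfolding h_def by (subst has_contour_integral_part_circlepath_iff) auto
  from I O show "g contour_integrable_on part_circlepath c R \<phi>1 \<phi>2"
    "g contour_integrable_on part_circlepath c R \<phi>2 (\<phi>1 + 2 * pi)"
    by (auto simp: contour_integrable_on_def)
  from contour_integral_unique[OF W] contour_integral_unique[OF I] contour_integral_unique[OF O]
  show "contour_integral (circlepath c R) g =
           contour_integral (part_circlepath c R \<phi>1 \<phi>2) g +
           contour_integral (part_circlepath c R \<phi>2 (\<phi>1 + 2 * pi)) g"
    by simp
qed

section \<open>Limits of the arc integrals as the radius grows\<close>

text \<open>Within the sector, the closeness of \<open>g (c + \<zeta>) * \<zeta>\<close> to
  \<open>a\<close> depends on the modulus of \<open>\<zeta>\<close> alone, hence holds at all inner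
  angles of a large arc at once.\<close>

lemma tendsto_sector_arc_integral:
  assumes "\<phi>1 < \<phi>2"
    and lim: "((\<lambda>\<zeta>. g (c + \<zeta>) * \<zeta>) \<longlongrightarrow> a)
           (inf at_infinity (principal {\<zeta>. c + \<zeta> \<in> sector c \<phi>1 \<phi>2}))"
    and int: "\<forall>\<^sub>F R in at_top. g contour_integrable_on part_circlepath c R \<phi>1 \<phi>2"
  shows "((\<lambda>R. contour_integral (part_circlepath c R \<phi>1 \<phi>2) g) \<longlongrightarrow> \<i> * of_real (\<phi>2 - \<phi>1) * a) at_top"
proof (rule tendstoI)
  fix e :: real assume "e > 0"
  \<comment> \<open>Integrated over an angle of \<open>\<phi>2 - \<phi>1\<close>, an error of at
    most \<open>d\<close> gives at most \<open>e / 2\<close>.\<close>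
  define d where "d = e / (2 * (\<phi>2 - \<phi>1))"
  have "d > 0"
    using \<open>e > 0\<close> assms(1) by (simp add: d_def)
  with lim have "\<forall>\<^sub>F \<zeta> in inf at_infinity (principal {\<zeta>. c + \<zeta> \<in> sector c \<phi>1 \<phi>2}).
      dist (g (c + \<zeta>) * \<zeta>) a < d"
    by (rule tendstoD)
  then obtain b where b: "dist (g (c + \<zeta>) * \<zeta>) a < d"
    if "norm \<zeta> \<ge> b" "c + \<zeta> \<in> sector c \<phi>1 \<phi>2" for \<zeta>
    unfolding eventually_inf_principal eventually_at_infinity by auto
  from int eventually_ge_at_top[of b] eventually_gt_at_top[of 0]
  show "\<forall>\<^sub>F R in at_top. dist (contour_integral (part_circlepath c R \<phi>1 \<phi>2) g)
      (\<i> * of_real (\<phi>2 - \<phi>1) * a) < e"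
  proof eventually_elim
    case (elim R)
    let ?I = "contour_integral (part_circlepath c R \<phi>1 \<phi>2) g"
    have "((\<lambda>t. g (c + R * cis t) * R * \<i> * cis t) has_integral ?I) {\<phi>1..\<phi>2}"
      using has_contour_integral_integral[OF elim(1)] assms(1)
      by (simp add: has_contour_integral_part_circlepath_iff)
    from has_integral_diff[OF this has_integral_const_real[of "\<i> * a" \<phi>1 \<phi>2]]
    have "((\<lambda>t. g (c + R * cis t) * R * \<i> * cis t - \<i> * a) has_integral
        (?I - \<i> * of_real (\<phi>2 - \<phi>1) * a)) (cbox \<phi>1 \<phi>2)"
      using assms(1) by (simp add: scaleR_conv_of_real mult_ac)
    moreover have "norm (g (c + R * cis t) * R * \<i> * cis t - \<i> * a) \<le> d"
      \<comment> \<open>The sector is open, so \<open>g\<close> is not controlled on the two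
        bounding rays; the estimate may skip these two angles.\<close>
      if "t \<in> cbox \<phi>1 \<phi>2 - {\<phi>1, \<phi>2}" for t
    proof -
      have "\<phi>1 < t" "t < \<phi>2"
        using that by auto
      then have "c + R * cis t \<in> sector c \<phi>1 \<phi>2"
        using elim by (auto simp: sector_def)
      with elim have "dist (g (c + R * cis t) * (R * cis t)) a < d"
        by (intro b) (auto simp: norm_mult)
      moreover have "g (c + R * cis t) * R * \<i> * cis t - \<i> * a =
          \<i> * (g (c + R * cis t) * (R * cis t) - a)"
        by (simp add: algebra_simps)
      ultimately show ?thesis
        by (simp add: dist_norm norm_mult)
    qed
    ultimately have "norm (?I - \<i> * of_real (\<phi>2 - \<phi>1) * a) \<le> d * measure lborel (cbox \<phi>1 \<phi>2)"
      using \<open>d > 0\<close> by (intro has_integral_bound_spike_finite[of d "{\<phi>1, \<phi>2}"]) auto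
    also have "\<dots> = e / 2"
      using assms(1) by (simp add: d_def field_simps)
    also have "\<dots> < e"
      using \<open>e > 0\<close> by simp
    finally show ?case
      by (simp add: dist_norm)
  qed
qed

lemma tendsto_exterior_arc_integral:
  assumes \<phi>: "0 \<le> \<phi>1" "\<phi>1 < \<phi>2" "\<phi>2 < 2 * pi"
    and lim: "((\<lambda>\<zeta>. g (c + \<zeta>) * \<zeta>) \<longlongrightarrow> a)
           (inf at_infinity (principal {\<zeta>. c + \<zeta> \<in> sector c \<phi>1 \<phi>2}))"
    and int: "\<forall>\<^sub>F R in at_top. g contour_integrable_on circlepath c R"
    and circ: "((\<lambda>R. contour_integral (circlepath c R) g) \<longlongrightarrow> L) at_top"
  shows "((\<lambda>R. contour_integral (part_circlepath c R \<phi>2 (\<phi>1 + 2 * pi)) g)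
           \<longlongrightarrow> L - \<i> * of_real (\<phi>2 - \<phi>1) * a) at_top"
proof -
  have "\<forall>\<^sub>F R in at_top. g contour_integrable_on part_circlepath c R \<phi>1 \<phi>2"
    using int by eventually_elim (rule circlepath_split(1)[OF _ \<phi>])
  from tendsto_diff[OF circ tendsto_sector_arc_integral[OF \<phi>(2) lim this]]
  show ?thesis
  proof (rule Lim_transform_eventually)
    show "\<forall>\<^sub>F R in at_top. contour_integral (circlepath c R) g -
        contour_integral (part_circlepath c R \<phi>1 \<phi>2) g =
        contour_integral (part_circlepath c R \<phi>2 (\<phi>1 + 2 * pi)) g"
      using int by eventually_elim (simp add: circlepath_split(3)[OF _ \<phi>])
  qed
qed

theorem lemma3p1:
  fixes f :: "complex \<Rightarrow> complex" and z\<^sub>C :: complex and \<phi>1 \<phi>2 \<alpha>1 :: real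
    and A S :: "complex ^ 2" and D :: "real \<Rightarrow> nat \<Rightarrow> real set \<times> real set"
  assumes "0 \<le> \<phi>1" and "\<phi>1 < \<phi>2" and "\<phi>2 < 2 * pi"
    and "\<alpha>1 = \<phi>2 - \<phi>1"
    and "((\<lambda>\<zeta>. f (z\<^sub>C + \<zeta>) *s (- cnj \<zeta> *s w1 + \<zeta> *s w2)) \<longlongrightarrow> A)
           (inf at_infinity (principal {\<zeta>. z\<^sub>C + \<zeta> \<in> sector z\<^sub>C \<phi>1 \<phi>2}))"
    and "\<forall>\<^sub>F R in at_top. vec_integrable f (circlepath z\<^sub>C R)"
    and "has_plane_residue_sum f z\<^sub>C D S"
  shows "has_exterior_integral f z\<^sub>C \<phi>1 \<phi>2
           ((2 * of_real pi * \<i>) *s S - (of_real \<alpha>1 * \<i>) *s A)"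
proof -
  let ?F = "inf at_infinity (principal {\<zeta>. z\<^sub>C + \<zeta> \<in> sector z\<^sub>C \<phi>1 \<phi>2})"
  let ?ext = "\<lambda>R. part_circlepath z\<^sub>C R \<phi>2 (\<phi>1 + 2 * pi)"
  let ?V = "(2 * of_real pi * \<i>) *s S - (of_real \<alpha>1 * \<i>) *s A"
  note split = circlepath_split[OF _ assms(1-3)]
  have "((\<lambda>\<zeta>. - (f (z\<^sub>C + \<zeta>) * cnj \<zeta>)) \<longlongrightarrow> A $ 1) ?F"
    using tendsto_vec_nth[OF assms(5), of 1] by (simp add: w1_def w2_def axis_def)
  \<comment> \<open>The first coordinate carries \<open>- cnj \<zeta>\<close>, so the scalar limit
    for \<open>cnj \<circ> f\<close> is \<open>- cnj (A $ 1)\<close>.\<close>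
  from tendsto_cnj[OF tendsto_minus[OF this]]
  have lim1: "((\<lambda>\<zeta>. (cnj \<circ> f) (z\<^sub>C + \<zeta>) * \<zeta>) \<longlongrightarrow> - cnj (A $ 1)) ?F"
    by simp
  have lim2: "((\<lambda>\<zeta>. f (z\<^sub>C + \<zeta>) * \<zeta>) \<longlongrightarrow> A $ 2) ?F"
    using tendsto_vec_nth[OF assms(5), of 2] by (simp add: w1_def w2_def axis_def)
  obtain T where T: "\<forall>\<^sub>F R in at_top. has_disc_residue_sum f z\<^sub>C R (D R) (T R)" "(T \<longlongrightarrow> S) at_top"
    using assms(7) by (auto simp: has_plane_residue_sum_def)
  have "((\<lambda>R. (2 * of_real pi * \<i>) *s T R) \<longlongrightarrow> (2 * of_real pi * \<i>) *s S) at_top"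
    by (rule vec_tendstoI) (auto intro!: tendsto_intros T)
  then have circ: "((\<lambda>R. vec_integral f (circlepath z\<^sub>C R)) \<longlongrightarrow> (2 * of_real pi * \<i>) *s S) at_top"
  proof (rule Lim_transform_eventually)
    show "\<forall>\<^sub>F R in at_top. (2 * of_real pi * \<i>) *s T R = vec_integral f (circlepath z\<^sub>C R)"
      using T(1) assms(6) eventually_gt_at_top[of 0]
      by eventually_elim (simp add: disc_residue_sum_eq)
  qed
  have circ1: "((\<lambda>R. contour_integral (circlepath z\<^sub>C R) (cnj \<circ> f))
      \<longlongrightarrow> cnj (2 * of_real pi * \<i> * S $ 1)) at_top"
    using tendsto_cnj[OF tendsto_vec_nth[OF circ, of 1]]
  \<comment> \<open>\<open>back_subst\<close> leaves a final goal in which the coordinate of the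
    scaled vector is rewritten as a scalar product.\<close>
  proof (rule Lim_transform_eventually[THEN back_subst[where P = "\<lambda>l. (_ \<longlongrightarrow> l) _"]])
    show "\<forall>\<^sub>F R in at_top. cnj (vec_integral f (circlepath z\<^sub>C R) $ 1) =
        contour_integral (circlepath z\<^sub>C R) (cnj \<circ> f)"
      using assms(6) by eventually_elim (simp add: vec_integral_nth)
  qed simp
  have circ2: "((\<lambda>R. contour_integral (circlepath z\<^sub>C R) f) \<longlongrightarrow> 2 * of_real pi * \<i> * S $ 2) at_top"
    using tendsto_vec_nth[OF circ, of 2]
  proof (rule Lim_transform_eventually[THEN back_subst[where P = "\<lambda>l. (_ \<longlongrightarrow> l) _"]])
    show "\<forall>\<^sub>F R in at_top. vec_integral f (circlepath z\<^sub>C R) $ 2 =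
        contour_integral (circlepath z\<^sub>C R) f"
      using assms(6) by eventually_elim (simp add: vec_integral_nth)
  qed simp
  have int1: "\<forall>\<^sub>F R in at_top. (cnj \<circ> f) contour_integrable_on circlepath z\<^sub>C R"
    and int2: "\<forall>\<^sub>F R in at_top. f contour_integrable_on circlepath z\<^sub>C R"
    using assms(6) by (auto simp: vec_integrable_iff elim: eventually_mono)
  have ext: "\<forall>\<^sub>F R in at_top. vec_integrable f (?ext R)"
    using int1 int2 by eventually_elim (simp add: vec_integrable_iff split)
  \<comment> \<open>Conjugating back changes the sign of the imaginary unit, which compensates the
    sign in \<open>lim1\<close>: both coordinates lose the same multiple of
    \<open>A\<close>.\<close>
  have "((\<lambda>R. cnj (contour_integral (?ext R) (cnj \<circ> f))) \<longlongrightarrow> ?V $ 1) at_top"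
    using tendsto_cnj[OF tendsto_exterior_arc_integral[OF assms(1-3) lim1 int1 circ1]] assms(4)
    by (simp add: mult_ac)
  moreover have "((\<lambda>R. contour_integral (?ext R) f) \<longlongrightarrow> ?V $ 2) at_top"
    using tendsto_exterior_arc_integral[OF assms(1-3) lim2 int2 circ2] assms(4)
    by (simp add: mult_ac)
  moreover have "\<forall>\<^sub>F R in at_top. cnj (contour_integral (?ext R) (cnj \<circ> f)) = vec_integral f (?ext R) $ 1"
    "\<forall>\<^sub>F R in at_top. contour_integral (?ext R) f = vec_integral f (?ext R) $ 2"
    using ext by (auto simp: vec_integral_nth elim: eventually_mono)
  ultimately have "((\<lambda>R. vec_integral f (?ext R) $ i) \<longlongrightarrow> ?V $ i) at_top" for i
    using exhaust_2[of i] by (auto intro: Lim_transform_eventually)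
  with ext show ?thesis
    unfolding has_exterior_integral_def by (blast intro: vec_tendstoI)
qed

end
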